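(* Let $N\ge 1$ be an integer, $\mathcal{N}=\{1,\dots,N\}$, and let $D>0$, $\tau_i>0$, $p_i\in(0,1]$, $\eta_i>0$, $\alpha_i>0$ $(i\in\mathcal{N})$ and a large constant $M$ be given. Let $P_1$ and $P_2$ be the two optimization problems defined in the context, $P_1$ being a mixed-integer nonlinear program in the variables $(n,k,\mathbf{c},\mathbf{x},\mathbf{t},T)$ and $P_2$ a mixed-integer linear program in the variables $(n,k,\mathbf{c},\mathbf{x},\mathbf{t},T,\mathbf{y})$. Then $P_2$ is equivalent to $P_1$: a tuple $(n,k,\mathbf{c},\mathbf{x},\mathbf{t},T)$ is feasible for $P_1$ if and only if there exists $\mathbf{y}\in\{0,1\}^N$ such that $(n,k,\mathbf{c},\mathbf{x},\mathbf{t},T,\mathbf{y})$ is feasible for $P_2$ (with the same objective value $T$ in both problems).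
   Context: Problem $P_1$: minimize $T$ over positive integers $n,k$, binary vectors $\mathbf{c}=(c_i)_{i\in\mathcal{N}}$, $\mathbf{x}=(x_i)_{i\in\mathcal{N}}\in\{0,1\}^N$, and real numbers $T$, $\mathbf{t}=(t_i)_{i\in\mathcal{N}}$, subject to (i) $\sum_{i\in\mathcal{N}}c_i=n$; (ii) $x_i\le c_i$ for all $i\in\mathcal{N}$; (iii) $\sum_{i\in\mathcal{N}}x_i=k$; (iv) $t_i+(1-x_i)M\ge \frac{2\tau_i}{p_i}+\frac{D}{k\eta_i}+\frac{D}{k\eta_i\alpha_i}$ for all $i\in\mathcal{N}$; (v) $T\ge t_i$ for all $i\in\mathcal{N}$; (vi) $k\le n$; (vii) $n\le N$. Problem $P_2$: minimize $T$ over the same variables together with $\mathbf{y}=(y_j)_{j\in\mathcal{N}}\in\{0,1\}^N$, subject to (i), (ii), (iii), (v), (vi), (vii) and, in place of (iv), the constraints (a) $\sum_{j\in\mathcal{N}}j\,y_j=k$; (b) $\sum_{j\in\mathcal{N}}y_j=1$; (c) $t_i+(1-x_i)M\ge \frac{2\tau_i}{p_i}+\sum_{j=1}^{N}y_j\left(\frac{D}{j\eta_i}+\frac{D}{j\eta_i\alpha_i}\right)$ for all $i\in\mathcal{N}$. The constant $M$ is a "big-M" constant, large enough that constraint (iv) forces a meaningful lower bound on $t_i$ only when $x_i=1$; concretely, $M\ge \frac{2\tau_i}{p_i}+\frac{D}{\eta_i}+\frac{D}{\eta_i\alpha_i}$ for every $i\in\mathcal{N}$. *)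

theory Defs
  imports Complex_Main "HOL-Library.FuncSet"
begin

record 'v min_problem =
  feasible :: "'v set"
  objective :: "'v \<Rightarrow> real"

text \<open>
  Vectors indexed by \<open>{1..N}\<close> are extensional functions on \<open>{1..N}\<close>, so that each vector has
  exactly one representation. Binary vectors take their values in \<open>{0, 1} :: nat set\<close>.
\<close>

abbreviation binary_vectors :: "nat \<Rightarrow> (nat \<Rightarrow> nat) set" where
  "binary_vectors N \<equiv> {1..N} \<rightarrow>\<^sub>E {0, 1}"

abbreviation real_vectors :: "nat \<Rightarrow> (nat \<Rightarrow> real) set" where
  "real_vectors N \<equiv> {1..N} \<rightarrow>\<^sub>E UNIV"

definition common_constraints ::
  "nat \<Rightarrow> nat \<Rightarrow> nat \<Rightarrow> (nat \<Rightarrow> nat) \<Rightarrow> (nat \<Rightarrow> nat) \<Rightarrow> (nat \<Rightarrow> real) \<Rightarrow> real \<Rightarrow> bool" where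
  "common_constraints N n k c x t T \<longleftrightarrow>
     0 < n \<and> 0 < k \<and>
     c \<in> binary_vectors N \<and> x \<in> binary_vectors N \<and> t \<in> real_vectors N \<and>
     (\<Sum>i\<in>{1..N}. c i) = n \<and>
     (\<forall>i\<in>{1..N}. x i \<le> c i) \<and>
     (\<Sum>i\<in>{1..N}. x i) = k \<and>
     (\<forall>i\<in>{1..N}. T \<ge> t i) \<and>
     k \<le> n \<and> n \<le> N"

definition P1 ::
  "nat \<Rightarrow> real \<Rightarrow> (nat \<Rightarrow> real) \<Rightarrow> (nat \<Rightarrow> real) \<Rightarrow> (nat \<Rightarrow> real) \<Rightarrow> (nat \<Rightarrow> real) \<Rightarrow> real \<Rightarrow>
   (nat \<times> nat \<times> (nat \<Rightarrow> nat) \<times> (nat \<Rightarrow> nat) \<times> (nat \<Rightarrow> real) \<times> real) min_problem" where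
  "P1 N D \<tau> p \<eta> \<alpha> M =
     \<lparr> feasible = {(n, k, c, x, t, T).
         common_constraints N n k c x t T \<and>
         (\<forall>i\<in>{1..N}. t i + (1 - real (x i)) * M \<ge>
            2 * \<tau> i / p i + D / (real k * \<eta> i) + D / (real k * \<eta> i * \<alpha> i))},
       objective = (\<lambda>(n, k, c, x, t, T). T) \<rparr>"

definition P2 ::
  "nat \<Rightarrow> real \<Rightarrow> (nat \<Rightarrow> real) \<Rightarrow> (nat \<Rightarrow> real) \<Rightarrow> (nat \<Rightarrow> real) \<Rightarrow> (nat \<Rightarrow> real) \<Rightarrow> real \<Rightarrow>
   (nat \<times> nat \<times> (nat \<Rightarrow> nat) \<times> (nat \<Rightarrow> nat) \<times> (nat \<Rightarrow> real) \<times> real \<times> (nat \<Rightarrow> nat)) min_problem" where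
  "P2 N D \<tau> p \<eta> \<alpha> M =
     \<lparr> feasible = {(n, k, c, x, t, T, y).
         common_constraints N n k c x t T \<and>
         y \<in> binary_vectors N \<and>
         (\<Sum>j\<in>{1..N}. j * y j) = k \<and>
         (\<Sum>j\<in>{1..N}. y j) = 1 \<and>
         (\<forall>i\<in>{1..N}. t i + (1 - real (x i)) * M \<ge>
            2 * \<tau> i / p i +
            (\<Sum>j\<in>{1..N}. real (y j) * (D / (real j * \<eta> i) + D / (real j * \<eta> i * \<alpha> i))))},
       objective = (\<lambda>(n, k, c, x, t, T, y). T) \<rparr>"

end

theory Submission
  imports Defs
begin

text \<open>
  The binary vectors with entry sum 1 are exactly the unit vectors. So (b) makes \<open>y\<close> the \<open>m\<close>-th unit
  vector for some \<open>m\<close>, (a) forces \<open>m = k\<close>, and the sum in (c) collapses to its \<open>k\<close>-th term, which is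
  the right-hand side of (iv). Conversely, \<open>k \<le> n \<le> N\<close> guarantees that the \<open>k\<close>-th unit vector exists.
\<close>

text \<open>The restricted lambda makes it extensional, so a binary vector can equal it as a
  function, not merely agree with it on \<open>{1..N}\<close>.\<close>

definition unit_vector :: "nat \<Rightarrow> nat \<Rightarrow> nat \<Rightarrow> nat" where
  "unit_vector N m = (\<lambda>j\<in>{1..N}. if j = m then 1 else 0)"

lemma unit_vector_binary: "unit_vector N m \<in> binary_vectors N"
  by (auto simp: unit_vector_def)

text \<open>Stated over a semiring via \<open>of_nat\<close> to serve both the natural-number sums
  in (a) and (b) and the real sum in (c).\<close>

lemma sum_unit_vector_mult:
  fixes f :: "nat \<Rightarrow> 'a::semiring_1"
  assumes "m \<in> {1..N}"
  shows "(\<Sum>j\<in>{1..N}. of_nat (unit_vector N m j) * f j) = f m"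
proof -
  have "(\<Sum>j\<in>{1..N}. of_nat (unit_vector N m j) * f j) = (\<Sum>j\<in>{1..N}. if j = m then f j else 0)"
    by (rule sum.cong) (auto simp: unit_vector_def)
  also have "\<dots> = f m"
    using assms by simp
  finally show ?thesis .
qed

lemma binary_vector_sum_1E:
  assumes y: "y \<in> binary_vectors N" and sum: "(\<Sum>j\<in>{1..N}. y j) = 1"
  obtains m where "m \<in> {1..N}" and "y = unit_vector N m"
proof -
  \<comment> \<open>Naturals that sum to 1 consist of a single 1 and otherwise zeros.\<close>
  obtain m where m: "m \<in> {1..N}" "y m = 1" "\<And>j. j \<in> {1..N} \<Longrightarrow> j \<noteq> m \<Longrightarrow> y j = 0"
    using sum sum_eq_1_iff[of "{1..N}" y] by auto
  have "y = unit_vector N m"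
  proof (rule PiE_ext[OF y unit_vector_binary])
    fix j assume "j \<in> {1..N}"
    then show "y j = unit_vector N m j"
      using m by (auto simp: unit_vector_def)
  qed
  with m(1) that show thesis by blast
qed

lemma binary_vector_selects_iff:
  assumes "k \<in> {1..N}"
  shows "y \<in> binary_vectors N \<and> (\<Sum>j\<in>{1..N}. j * y j) = k \<and> (\<Sum>j\<in>{1..N}. y j) = 1
    \<longleftrightarrow> y = unit_vector N k"
proof -
  \<comment> \<open>Needed for all \<open>m\<close>, not just \<open>k\<close>: the forward
    direction starts from an unknown \<open>m\<close>, which the first sum then identifies with
    \<open>k\<close>.\<close>
  have sums: "(\<Sum>j\<in>{1..N}. j * unit_vector N m j) = m" "(\<Sum>j\<in>{1..N}. unit_vector N m j) = 1"
    if "m \<in> {1..N}" for m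
    using sum_unit_vector_mult[OF that, of "\<lambda>j. j"] sum_unit_vector_mult[OF that, of "\<lambda>_. 1 :: nat"]
    by (simp_all add: mult.commute)
  show ?thesis
    using assms sums unit_vector_binary by (metis binary_vector_sum_1E)
qed

lemma P1_feasible_iff:
  "(n, k, c, x, t, T) \<in> feasible (P1 N D \<tau> p \<eta> \<alpha> M) \<longleftrightarrow>
   (\<exists>y\<in>binary_vectors N. (n, k, c, x, t, T, y) \<in> feasible (P2 N D \<tau> p \<eta> \<alpha> M))"
\<comment> \<open>If the shared constraints fail, both sides are false; otherwise only (iv) and
  (a)-(c) remain to be compared.\<close>
proof (cases "common_constraints N n k c x t T")
  case True
  then have k: "k \<in> {1..N}"
    by (auto simp: common_constraints_def)
  have "(\<exists>y\<in>binary_vectors N. (n, k, c, x, t, T, y) \<in> feasible (P2 N D \<tau> p \<eta> \<alpha> M)) \<longleftrightarrow>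
      (\<exists>y. (y \<in> binary_vectors N \<and> (\<Sum>j\<in>{1..N}. j * y j) = k \<and> (\<Sum>j\<in>{1..N}. y j) = 1) \<and>
        (\<forall>i\<in>{1..N}. t i + (1 - real (x i)) * M \<ge> 2 * \<tau> i / p i +
          (\<Sum>j\<in>{1..N}. real (y j) * (D / (real j * \<eta> i) + D / (real j * \<eta> i * \<alpha> i)))))"
    unfolding P2_def using True by auto
  also have "\<dots> \<longleftrightarrow> (\<forall>i\<in>{1..N}. t i + (1 - real (x i)) * M \<ge> 2 * \<tau> i / p i +
      (\<Sum>j\<in>{1..N}. real (unit_vector N k j) * (D / (real j * \<eta> i) + D / (real j * \<eta> i * \<alpha> i))))"
    \<comment> \<open>Conditions (a) and (b) have become an equation for \<open>y\<close>, so the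
      one-point rule removes the quantifier.\<close>
    unfolding binary_vector_selects_iff[OF k] by simp
  also have "\<dots> \<longleftrightarrow> (n, k, c, x, t, T) \<in> feasible (P1 N D \<tau> p \<eta> \<alpha> M)"
    \<comment> \<open>The collapsed sum brackets the two \<open>D\<close> terms together, unlike
      (iv); associativity reconciles them.\<close>
    unfolding sum_unit_vector_mult[OF k] P1_def using True by (simp add: add.assoc)
  finally show ?thesis ..
next
  case False
  then show ?thesis
    by (simp add: P1_def P2_def)
qed

theorem proposition2:
  fixes N :: nat and D M :: real and \<tau> p \<eta> \<alpha> :: "nat \<Rightarrow> real"
  assumes "N \<ge> 1"
    and "D > 0"
    and "\<And>i. i \<in> {1..N} \<Longrightarrow> \<tau> i > 0"
    and "\<And>i. i \<in> {1..N} \<Longrightarrow> 0 < p i \<and> p i \<le> 1"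
    and "\<And>i. i \<in> {1..N} \<Longrightarrow> \<eta> i > 0"
    and "\<And>i. i \<in> {1..N} \<Longrightarrow> \<alpha> i > 0"
    and "\<And>i. i \<in> {1..N} \<Longrightarrow> M \<ge> 2 * \<tau> i / p i + D / \<eta> i + D / (\<eta> i * \<alpha> i)"
  shows "(\<forall>n k c x t T.
            (n, k, c, x, t, T) \<in> feasible (P1 N D \<tau> p \<eta> \<alpha> M) \<longleftrightarrow>
            (\<exists>y\<in>binary_vectors N. (n, k, c, x, t, T, y) \<in> feasible (P2 N D \<tau> p \<eta> \<alpha> M))) \<and>
         (\<forall>n k c x t T y.
            objective (P2 N D \<tau> p \<eta> \<alpha> M) (n, k, c, x, t, T, y) =
            objective (P1 N D \<tau> p \<eta> \<alpha> M) (n, k, c, x, t, T))"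
  by (simp only: P1_feasible_iff) (simp add: P1_def P2_def)

end
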